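(* If $p,q\in\mathcal{O}$ with $q\ne0$ and $p/q$ is not a convergent of $z$, then $$|q_n(q_nz-p_n)|<\frac{4\varepsilon\mu^2|q(qz-p)|}{(1-\varepsilon^2)^2}$$ for every $n\geq1$. That is, each $p_n/q_n$ is a best approximation of the second kind up to constants: if $rs\geq(1-\varepsilon^2)^2/4\mu^2$, then $0<|q|<r|q_n|$ implies $|qz-p|>s|q_nz-p_n|$ for any $p\in\mathcal{O}$, except perhaps when $p/q$ is already a convergent.
   Context: Let $\mathcal{O}=\mathbb{Z}[\tau]$ be the ring of discriminant $\Delta$ in an imaginary quadratic field $K$. An ideal is reduced if it is integral and has minimal norm among integral ideals in its class; $D(z,r)$ is the closed disc of radius $r$ centered at $z$. A nonempty finite $B\subset\mathcal{O}\setminus\{0\}$ is admissible with $\varepsilon\in(0,1)$ if for every reduced ideal $\mathfrak{b}$ with $\mathfrak{b}\cap B\neq\emptyset$, $\mathbb{C}=\bigcup D(a/b,\varepsilon/|b|)$ over $a\in\mathfrak{b}^{-1}$, $b\in\mathfrak{b}\cap B$ with $(a\mathfrak{b},b/\mathfrak{b})$ reduced. Fix such $B,\varepsilon$ and let $\mu=\max_{b\in B}|b|$. Let $S(a,b)=\begin{bmatrix}a&1\\ b&0\end{bmatrix}$, $(M)_1$ the ideal generated by the first-column entries of $M$; matrices act as Möbius transformations. Given $z\in\mathbb{C}$, the continued fraction algorithm sets $M_0=I$, $b_0=1$, and for $n\ge1$ chooses (in any way) $b_n\in B$ and $a_n\in\mathcal{O}\cap D(b_nM_{n-1}^{-1}(z),\varepsilon|b_{n-1}|)$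 with $(M_{n-1}S(a_n/b_{n-1},b_n/b_{n-1}))_1$ reduced, and sets $M_n=M_{n-1}S(a_n/b_{n-1},b_n/b_{n-1})$, stopping if $z$ equals the first-column ratio of $M_n$. Let $p_n,q_n$ be the left-column entries of $M_n$; the $p_n/q_n$ are the convergents of $z$.
   Formalization: The condition rs ≥ (1−ε²)²/4μ² in the second sentence is reversed to rs ≤ (1−ε²)²/4μ²; as printed it is false, since for fixed non-convergent p/q and q_n z ≠ p_n, s may be taken arbitrarily large. The first inequality is unchanged. *)

theory Defs
  imports "HOL-Analysis.Analysis" "HOL-Library.Extended_Nat" "HOL-Algebra.QuotRing"
begin

text \<open>
  The quadratic order of discriminant \<open>\<Delta>\<close> is embedded in the complex numbers. The generator
  satisfies \<open>\<tau>\<^sup>2 - \<Delta> \<tau> + (\<Delta>\<^sup>2 - \<Delta>) / 4 = 0\<close>, whose discriminant is \<open>\<Delta>\<close>.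
\<close>

definition quad_tau :: "int \<Rightarrow> complex" where
  "quad_tau \<Delta> = (of_int \<Delta> + \<i> * of_real (sqrt \<bar>of_int \<Delta>\<bar>)) / 2"

definition quad_order :: "int \<Rightarrow> complex set" where
  "quad_order \<Delta> = {of_int x + of_int y * quad_tau \<Delta> | x y :: int. True}"

definition quad_field :: "int \<Rightarrow> complex set" where
  "quad_field \<Delta> = {of_rat x + of_rat y * quad_tau \<Delta> | x y :: rat. True}"

definition quad_ring :: "int \<Rightarrow> complex ring" where
  "quad_ring \<Delta> = \<lparr>carrier = quad_order \<Delta>, monoid.mult = (*), one = 1, zero = 0, add = (+)\<rparr>"

lemma quad_tau_square:
  assumes "\<Delta> < 0" "\<Delta> mod 4 \<in> {0, 1}"
  shows "quad_tau \<Delta> * quad_tau \<Delta> = of_int \<Delta> * quad_tau \<Delta> - of_int ((\<Delta>\<^sup>2 - \<Delta>) div 4)"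
proof -
  have "\<Delta> = 4 * (\<Delta> div 4) \<or> \<Delta> = 4 * (\<Delta> div 4) + 1"
    using assms(2) unfolding insert_iff empty_iff by presburger
  then obtain d where d: "\<Delta> = 4 * d \<or> \<Delta> = 4 * d + 1" by blast
  have "4 * d * (4 * d) - 4 * d = 4 * (4 * d * d - d)"
    and "(4 * d + 1) * (4 * d + 1) - (4 * d + 1) = 4 * (4 * d * d + d)"
    by (simp_all add: algebra_simps)
  with d have "4 dvd \<Delta>\<^sup>2 - \<Delta>"
    unfolding power2_eq_square by (metis dvd_triv_left)
  then obtain k where k: "\<Delta>\<^sup>2 - \<Delta> = 4 * k" by (elim dvdE)
  define s where "s = complex_of_real (sqrt \<bar>of_int \<Delta>\<bar>)"
  have s: "s * s = - of_int \<Delta>"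
    unfolding s_def using assms(1) by (simp flip: of_real_mult)
  have k': "(of_int \<Delta> :: complex) * of_int \<Delta> - of_int \<Delta> = 4 * of_int k"
    using arg_cong[OF k, of "of_int :: int \<Rightarrow> complex"] by (simp add: power2_eq_square)
  have "4 * (quad_tau \<Delta> * quad_tau \<Delta>) = of_int \<Delta> * of_int \<Delta> + 2 * \<i> * s * of_int \<Delta> - s * s"
    unfolding quad_tau_def s_def[symmetric] by (simp add: field_simps)
  also have "\<dots> = 4 * (of_int \<Delta> * quad_tau \<Delta> - of_int k)"
    unfolding s right_diff_distrib k'[symmetric] unfolding quad_tau_def s_def[symmetric]
    by (simp add: field_simps)
  finally have "quad_tau \<Delta> * quad_tau \<Delta> = of_int \<Delta> * quad_tau \<Delta> - of_int k"
    by (subst (asm) mult_cancel_left) simp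
  then show ?thesis using k by simp
qed

lemma cring_quad_ring:
  assumes "\<Delta> < 0" "\<Delta> mod 4 \<in> {0, 1}"
  shows "cring (quad_ring \<Delta>)"
proof -
  define t where "t = quad_tau \<Delta>"
  define k where "k = (\<Delta>\<^sup>2 - \<Delta>) div 4"
  have t: "t * t = of_int \<Delta> * t - of_int k"
    unfolding t_def k_def by (rule quad_tau_square[OF assms])
  have mem: "of_int x + of_int y * t \<in> quad_order \<Delta>" for x y
    unfolding quad_order_def t_def by blast
  have cases: "\<exists>x y. u = of_int x + of_int y * t" if "u \<in> quad_order \<Delta>" for u
    using that unfolding quad_order_def t_def by blast
  have add: "u + v \<in> quad_order \<Delta>" if uv: "u \<in> quad_order \<Delta>" "v \<in> quad_order \<Delta>" for u v
  proof -
    obtain x y x' y' where "u = of_int x + of_int y * t" "v = of_int x' + of_int y' * t"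
      using uv cases by metis
    then have "u + v = of_int (x + x') + of_int (y + y') * t" by (simp add: algebra_simps)
    then show ?thesis using mem by metis
  qed
  have mult: "u * v \<in> quad_order \<Delta>" if uv: "u \<in> quad_order \<Delta>" "v \<in> quad_order \<Delta>" for u v
  proof -
    obtain x y x' y' where e: "u = of_int x + of_int y * t" "v = of_int x' + of_int y' * t"
      using uv cases by metis
    have "u * v = of_int x * of_int x' + (of_int x * of_int y' + of_int y * of_int x') * t
        + of_int y * of_int y' * (t * t)"
      unfolding e by (simp add: algebra_simps)
    also have "\<dots> = of_int (x * x' - y * y' * k) + of_int (x * y' + y * x' + y * y' * \<Delta>) * t"
      unfolding t by (simp add: algebra_simps)
    finally show ?thesis using mem by metis
  qed
  have neg: "- u \<in> quad_order \<Delta>" if u: "u \<in> quad_order \<Delta>" for u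
  proof -
    obtain x y where "u = of_int x + of_int y * t" using u cases by metis
    then have "- u = of_int (- x) + of_int (- y) * t" by simp
    then show ?thesis using mem by metis
  qed
  have zero: "0 \<in> quad_order \<Delta>" using mem[of 0 0] by simp
  have one: "1 \<in> quad_order \<Delta>" using mem[of 1 0] by simp
  show ?thesis
  proof (rule cringI)
    show "abelian_group (quad_ring \<Delta>)"
    proof (rule abelian_groupI)
      fix u assume "u \<in> carrier (quad_ring \<Delta>)"
      then show "\<exists>y\<in>carrier (quad_ring \<Delta>). y \<oplus>\<^bsub>quad_ring \<Delta>\<^esub> u = \<zero>\<^bsub>quad_ring \<Delta>\<^esub>"
        by (intro bexI[of _ "- u"]) (auto simp: quad_ring_def neg)
    qed (auto simp: quad_ring_def add zero)
    show "comm_monoid (quad_ring \<Delta>)"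
      by (rule comm_monoidI) (auto simp: quad_ring_def mult one)
  qed (auto simp: quad_ring_def algebra_simps)
qed

text \<open>For an integral ideal this is the index in the order.\<close>

definition ideal_norm :: "int \<Rightarrow> complex set \<Rightarrow> nat" where
  "ideal_norm \<Delta> \<aa> = card (carrier (quad_ring \<Delta> Quot \<aa>))"

definition same_class :: "int \<Rightarrow> complex set \<Rightarrow> complex set \<Rightarrow> bool" where
  "same_class \<Delta> \<aa> \<cc> \<longleftrightarrow> (\<exists>l \<in> quad_field \<Delta> - {0}. \<cc> = (*) l ` \<aa>)"

definition reduced_ideal :: "int \<Rightarrow> complex set \<Rightarrow> bool" where
  "reduced_ideal \<Delta> \<aa> \<longleftrightarrow> ideal \<aa> (quad_ring \<Delta>) \<and> \<aa> \<noteq> {0} \<and>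
     (\<forall>\<cc>. ideal \<cc> (quad_ring \<Delta>) \<and> same_class \<Delta> \<aa> \<cc> \<longrightarrow> ideal_norm \<Delta> \<aa> \<le> ideal_norm \<Delta> \<cc>)"

definition inv_ideal :: "int \<Rightarrow> complex set \<Rightarrow> complex set" where
  "inv_ideal \<Delta> \<bb> = {x \<in> quad_field \<Delta>. \<forall>y\<in>\<bb>. x * y \<in> quad_order \<Delta>}"

text \<open>
  The fractional ideal \<open>(a\<bb>, b/\<bb>) = a\<bb> + b\<bb>\<^sup>-\<^sup>1\<close>; both summands are already modules over the order.
\<close>

definition twisted_ideal :: "int \<Rightarrow> complex set \<Rightarrow> complex \<Rightarrow> complex \<Rightarrow> complex set" where
  "twisted_ideal \<Delta> \<bb> a b = {a * x + b * y | x y. x \<in> \<bb> \<and> y \<in> inv_ideal \<Delta> \<bb>}"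

definition admissible :: "int \<Rightarrow> complex set \<Rightarrow> real \<Rightarrow> bool" where
  "admissible \<Delta> B \<epsilon> \<longleftrightarrow>
     finite B \<and> B \<noteq> {} \<and> B \<subseteq> quad_order \<Delta> - {0} \<and> 0 < \<epsilon> \<and> \<epsilon> < 1 \<and>
     (\<forall>\<bb>. reduced_ideal \<Delta> \<bb> \<and> \<bb> \<inter> B \<noteq> {} \<longrightarrow>
        (UNIV :: complex set) =
          \<Union> {cball (a / b) (\<epsilon> / cmod b) | a b.
               a \<in> inv_ideal \<Delta> \<bb> \<and> b \<in> \<bb> \<inter> B \<and> reduced_ideal \<Delta> (twisted_ideal \<Delta> \<bb> a b)})"

definition S_mat :: "complex \<Rightarrow> complex \<Rightarrow> complex ^ 2 ^ 2" where
  "S_mat a b = vector [vector [a, 1], vector [b, 0]]"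

definition moebius_act :: "complex ^ 2 ^ 2 \<Rightarrow> complex \<Rightarrow> complex" where
  "moebius_act M z = (M $ 1 $ 1 * z + M $ 1 $ 2) / (M $ 2 $ 1 * z + M $ 2 $ 2)"

definition col1_ideal :: "int \<Rightarrow> complex ^ 2 ^ 2 \<Rightarrow> complex set" where
  "col1_ideal \<Delta> M = {M $ 1 $ 1 * x + M $ 2 $ 1 * y | x y. x \<in> quad_order \<Delta> \<and> y \<in> quad_order \<Delta>}"

fun cf_mat :: "(nat \<Rightarrow> complex) \<Rightarrow> (nat \<Rightarrow> complex) \<Rightarrow> nat \<Rightarrow> complex ^ 2 ^ 2" where
  "cf_mat a b 0 = mat 1"
| "cf_mat a b (Suc n) = cf_mat a b n ** S_mat (a (Suc n) / b n) (b (Suc n) / b n)"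

definition cf_p :: "(nat \<Rightarrow> complex) \<Rightarrow> (nat \<Rightarrow> complex) \<Rightarrow> nat \<Rightarrow> complex" where
  "cf_p a b n = cf_mat a b n $ 1 $ 1"

definition cf_q :: "(nat \<Rightarrow> complex) \<Rightarrow> (nat \<Rightarrow> complex) \<Rightarrow> nat \<Rightarrow> complex" where
  "cf_q a b n = cf_mat a b n $ 2 $ 1"

text \<open>
  The finite number \<open>w\<close> equals the ratio \<open>p\<^sub>n / q\<^sub>n\<close> in the Riemann sphere. The condition on \<open>q\<^sub>n\<close> is
  needed because \<open>p\<^sub>0 / q\<^sub>0 = 1 / 0\<close> is the point at infinity, not \<open>0\<close>.
\<close>

definition eq_ratio :: "(nat \<Rightarrow> complex) \<Rightarrow> (nat \<Rightarrow> complex) \<Rightarrow> nat \<Rightarrow> complex \<Rightarrow> bool" where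
  "eq_ratio a b n w \<longleftrightarrow> cf_q a b n \<noteq> 0 \<and> w = cf_p a b n / cf_q a b n"

text \<open>
  A complete execution of the algorithm on \<open>z\<close> with some choices \<open>a\<close>, \<open>b\<close>: the matrices produced
  are those with index at most \<open>N\<close>, where \<open>N = \<infinity>\<close> if the stopping condition is never met, and
  otherwise \<open>N\<close> is the index at which it is met. The value \<open>a 0\<close> is never used.
  The inverse of the previous matrix maps \<open>z\<close> to infinity only if the algorithm has already stopped,
  so the division in \<^const>\<open>moebius_act\<close> is never by zero here.
\<close>

definition cf_run ::
  "int \<Rightarrow> complex set \<Rightarrow> real \<Rightarrow> complex \<Rightarrow> (nat \<Rightarrow> complex) \<Rightarrow> (nat \<Rightarrow> complex) \<Rightarrow> enat \<Rightarrow> bool" where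
  "cf_run \<Delta> B \<epsilon> z a b N \<longleftrightarrow>
     b 0 = 1 \<and>
     (\<forall>n\<ge>1. enat n \<le> N \<longrightarrow>
        b n \<in> B \<and>
        a n \<in> quad_order \<Delta> \<inter>
          cball (b n * moebius_act (matrix_inv (cf_mat a b (n - 1))) z) (\<epsilon> * cmod (b (n - 1))) \<and>
        reduced_ideal \<Delta> (col1_ideal \<Delta> (cf_mat a b n))) \<and>
     (\<forall>n. enat n \<le> N \<longrightarrow> (eq_ratio a b n z \<longleftrightarrow> N = enat n))"

definition is_convergent :: "(nat \<Rightarrow> complex) \<Rightarrow> (nat \<Rightarrow> complex) \<Rightarrow> enat \<Rightarrow> complex \<Rightarrow> bool" where
  "is_convergent a b N w \<longleftrightarrow> (\<exists>n. enat n \<le> N \<and> eq_ratio a b n w)"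

end

theory Submission imports Defs begin

text \<open>
  Put \<open>e\<^sub>n = q\<^sub>n z - p\<^sub>n\<close>. The choice of \<open>a\<^sub>n\<close> gives \<open>|e\<^sub>n| \<le> \<epsilon> |e\<^sub>n\<^sub>-\<^sub>1|\<close>, and the determinant
  identity \<open>|q\<^sub>n e\<^sub>n\<^sub>-\<^sub>1 - q\<^sub>n\<^sub>-\<^sub>1 e\<^sub>n| = |b\<^sub>n| \<le> \<mu>\<close> then yields \<open>|q\<^sub>n e\<^sub>n\<^sub>-\<^sub>1| < \<mu> / (1 - \<epsilon>\<^sup>2)\<close> by summing
  a geometric series; hence \<open>|q\<^sub>n e\<^sub>n| < \<epsilon> \<mu> / (1 - \<epsilon>\<^sup>2)\<close>.
  If \<open>p/q\<close> is not a convergent and \<open>e = q z - p\<close>, then \<open>q e\<^sub>n - q\<^sub>n e = q\<^sub>n p - q p\<^sub>n\<close> is a nonzero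
  element of the order, so \<open>|q e\<^sub>n| + |q\<^sub>n e| \<ge> 1\<close> for all \<open>n\<close>. At the index \<open>n\<close> where \<open>|q e\<^sub>n|\<close> first
  drops to at most \<open>1/2\<close> both \<open>|q e\<^sub>n\<^sub>-\<^sub>1|\<close> and \<open>|q\<^sub>n e|\<close> are at least \<open>1/2\<close>, and dividing their product
  by \<open>|q\<^sub>n e\<^sub>n\<^sub>-\<^sub>1|\<close> shows \<open>|q e| > (1 - \<epsilon>\<^sup>2) / (4 \<mu>)\<close>.
\<close>

section \<open>Arithmetic of the quadratic order\<close>

lemma quad_order_diff_mult:
  assumes "\<Delta> < 0" "\<Delta> mod 4 \<in> {0, 1}"
    and "u \<in> quad_order \<Delta>" "v \<in> quad_order \<Delta>" "x \<in> quad_order \<Delta>" "y \<in> quad_order \<Delta>"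
  shows "u * v - x * y \<in> quad_order \<Delta>"
proof -
  interpret cring "quad_ring \<Delta>" by (rule cring_quad_ring[OF assms(1,2)])
  have c: "carrier (quad_ring \<Delta>) = quad_order \<Delta>" by (simp add: quad_ring_def)
  have mult: "s * t \<in> quad_order \<Delta>" if "s \<in> quad_order \<Delta>" "t \<in> quad_order \<Delta>" for s t
    using m_closed[of s t] that unfolding c by (simp add: quad_ring_def)
  have add: "s + t \<in> quad_order \<Delta>" if "s \<in> quad_order \<Delta>" "t \<in> quad_order \<Delta>" for s t
    using a_closed[of s t] that unfolding c by (simp add: quad_ring_def)
  have "of_int (-1) + of_int 0 * quad_tau \<Delta> \<in> quad_order \<Delta>"
    unfolding quad_order_def by blast
  then have "-1 \<in> quad_order \<Delta>" by simp
  then have "u * v + -1 * (x * y) \<in> quad_order \<Delta>"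
    by (intro add mult assms(3-6))
  then show ?thesis by simp
qed

text \<open>The squared modulus of an element is its norm, a rational integer, and a positive
  integer is at least 1.\<close>

lemma one_le_cmod_quad_order:
  assumes "\<Delta> < 0" "\<Delta> mod 4 \<in> {0, 1}" and u: "u \<in> quad_order \<Delta>" "u \<noteq> 0"
  shows "1 \<le> cmod u"
proof -
  define t where "t = quad_tau \<Delta>"
  define k where "k = (\<Delta>\<^sup>2 - \<Delta>) div 4"
  have t: "t * t = of_int \<Delta> * t - of_int k"
    unfolding t_def k_def by (rule quad_tau_square[OF assms(1,2)])
  have ct: "cnj t = of_int \<Delta> - t"
    unfolding t_def quad_tau_def by (simp add: complex_eq_iff)
  obtain x y where xy: "u = of_int x + of_int y * t"
    using u(1) unfolding quad_order_def t_def by blast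
  \<comment> \<open>The norm form in the coordinates \<open>x\<close>, \<open>y\<close>: the
    generator \<open>t\<close> has trace \<Delta> and norm \<open>k\<close>.\<close>
  define m where "m = x * x + x * y * \<Delta> + y * y * k"
  have "of_real ((cmod u)\<^sup>2) = u * cnj u" by (rule complex_norm_square)
  also have "\<dots> = of_int x * of_int x + of_int x * of_int y * of_int \<Delta>
      + of_int y * of_int y * (of_int \<Delta> * t - t * t)"
    unfolding xy by (simp add: ct algebra_simps)
  also have "\<dots> = of_real (of_int m)" unfolding t m_def by simp
  finally have m: "(cmod u)\<^sup>2 = of_int m" by (simp only: of_real_eq_iff)
  have "0 < (cmod u)\<^sup>2" using u(2) by simp
  then have "1 \<le> m" unfolding m by simp
  then have "1\<^sup>2 \<le> (cmod u)\<^sup>2" unfolding m by simp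
  then show ?thesis by (rule power2_le_imp_le) simp
qed

text \<open>The factors of \<open>cf_mat\<close> have entries such as
  \<open>a (Suc n) / b n\<close>, which need not lie in the order. Integrality comes from
  reducedness: a reduced ideal lies inside the order, and this one contains both column
  entries.\<close>

lemma col1_entries_in_order:
  assumes "\<Delta> < 0" "\<Delta> mod 4 \<in> {0, 1}" and "reduced_ideal \<Delta> (col1_ideal \<Delta> M)"
  shows "M $ 1 $ 1 \<in> quad_order \<Delta>" "M $ 2 $ 1 \<in> quad_order \<Delta>"
proof -
  have "of_int 0 + of_int 0 * quad_tau \<Delta> \<in> quad_order \<Delta>"
    "of_int 1 + of_int 0 * quad_tau \<Delta> \<in> quad_order \<Delta>"
    unfolding quad_order_def by blast+
  then have z: "0 \<in> quad_order \<Delta>" "1 \<in> quad_order \<Delta>" by simp_all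
  have "ideal (col1_ideal \<Delta> M) (quad_ring \<Delta>)"
    using assms(3) unfolding reduced_ideal_def by blast
  then have sub: "col1_ideal \<Delta> M \<subseteq> quad_order \<Delta>"
    using ideal.Icarr by (fastforce simp: quad_ring_def)
  have "M $ 1 $ 1 * 1 + M $ 2 $ 1 * 0 \<in> col1_ideal \<Delta> M"
    "M $ 1 $ 1 * 0 + M $ 2 $ 1 * 1 \<in> col1_ideal \<Delta> M"
    unfolding col1_ideal_def using z by blast+
  then show "M $ 1 $ 1 \<in> quad_order \<Delta>" "M $ 2 $ 1 \<in> quad_order \<Delta>"
    using sub by auto
qed

section \<open>Inverses, columns and determinants of the matrices\<close>

lemma moebius_act_matrix_inv:
  fixes M :: "complex ^ 2 ^ 2"
  assumes "det M \<noteq> 0"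
  shows "moebius_act (matrix_inv M) z
    = (M $ 2 $ 2 * z - M $ 1 $ 2) / (M $ 1 $ 1 - M $ 2 $ 1 * z)"
proof -
  define d where "d = det M"
  have d: "d \<noteq> 0" "d = M $ 1 $ 1 * M $ 2 $ 2 - M $ 1 $ 2 * M $ 2 $ 1"
    using assms by (simp_all add: d_def det_2)
  \<comment> \<open>The adjugate divided by the determinant; the common factor \<open>1 / d\<close>
    cancels in the Moebius action.\<close>
  define X :: "complex ^ 2 ^ 2"
    where "X = vector [vector [M $ 2 $ 2 / d, - M $ 1 $ 2 / d],
                       vector [- M $ 2 $ 1 / d, M $ 1 $ 1 / d]]"
  have "M $ 1 $ 1 * M $ 2 $ 2 / d - M $ 1 $ 2 * M $ 2 $ 1 / d = 1"
    using d(1) by (simp only: diff_divide_distrib[symmetric] d(2)[symmetric]) simp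
  then have "M ** X = mat 1"
    by (simp add: X_def vec_eq_iff forall_2 matrix_matrix_mult_def sum_2 mat_def mult.commute)
  moreover from this have "X ** M = mat 1" using matrix_left_right_inverse by blast
  ultimately have X: "M ** X = mat 1 \<and> X ** M = mat 1" ..
  moreover from X have "M ** matrix_inv M = mat 1 \<and> matrix_inv M ** M = mat 1"
    \<comment> \<open>\<open>matrix_inv\<close> is a choice among two-sided inverses:
      \<open>X\<close> shows that one exists, and uniqueness then identifies the two.\<close>
    unfolding matrix_inv_def by (rule someI)
  ultimately have "matrix_inv M = X"
    by (metis matrix_mul_assoc matrix_mul_lid matrix_mul_rid)
  then have "moebius_act (matrix_inv M) z =
     ((M $ 2 $ 2 * z - M $ 1 $ 2) / d) / ((M $ 1 $ 1 - M $ 2 $ 1 * z) / d)"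
    by (simp add: moebius_act_def X_def diff_divide_distrib)
  then show ?thesis using d(1) by simp
qed

lemma cf_mat_Suc:
  "cf_mat a b (Suc n) $ i $ 1
     = cf_mat a b n $ i $ 1 * (a (Suc n) / b n) + cf_mat a b n $ i $ 2 * (b (Suc n) / b n)"
  "cf_mat a b (Suc n) $ i $ 2 = cf_mat a b n $ i $ 1"
  by (simp_all add: matrix_matrix_mult_def sum_2 S_mat_def)

text \<open>Each factor has determinant \<open>- (b (Suc n) / b n)\<close>, so the product
  telescopes from \<open>b 0 = 1\<close>. Only earlier values are divided by, hence the strict bound
  \<open>k < n\<close>.\<close>

lemma det_cf_mat:
  assumes "b 0 = 1" and "\<And>k. k < n \<Longrightarrow> b k \<noteq> 0"
  shows "det (cf_mat a b n) = (-1) ^ n * b n"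
  using assms(2)
proof (induction n)
  case 0
  then show ?case using assms(1) by simp
next
  case (Suc n)
  then have "det (cf_mat a b n) = (-1) ^ n * b n" "b n \<noteq> 0" by simp_all
  moreover have "det (S_mat (a (Suc n) / b n) (b (Suc n) / b n)) = - (b (Suc n) / b n)"
    by (simp add: S_mat_def det_2)
  ultimately show ?case by (simp add: det_mul)
qed

section \<open>A complete run: integrality, nonvanishing and stopping\<close>

definition cf_err :: "complex \<Rightarrow> (nat \<Rightarrow> complex) \<Rightarrow> (nat \<Rightarrow> complex) \<Rightarrow> nat \<Rightarrow> complex" where
  "cf_err z a b n = cf_q a b n * z - cf_p a b n"

locale cf_execution =
  fixes \<Delta> :: int and B :: "complex set" and \<epsilon> \<mu> :: real and z :: complex
    and a b :: "nat \<Rightarrow> complex" and N :: enat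
  assumes disc: "\<Delta> < 0" "\<Delta> mod 4 \<in> {0, 1}"
    and adm: "admissible \<Delta> B \<epsilon>"
    and mu: "\<mu> = Max (cmod ` B)"
    and run: "cf_run \<Delta> B \<epsilon> z a b N"
begin

abbreviation "P \<equiv> cf_p a b"
abbreviation "Q \<equiv> cf_q a b"
abbreviation "E \<equiv> cf_err z a b"

lemma eps: "0 < \<epsilon>" "\<epsilon> < 1" "\<epsilon>\<^sup>2 < 1"
  using adm by (auto simp: admissible_def power_less_one_iff)

lemma b0: "b 0 = 1"
  using run by (simp add: cf_run_def)

lemma start: "P 0 = 1" "Q 0 = 0" "E 0 = -1"
  by (simp_all add: cf_err_def cf_p_def cf_q_def mat_def)

lemma b_in: "b n \<in> B" if "1 \<le> n" "enat n \<le> N"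
  using run that unfolding cf_run_def by blast

lemma b_nonzero: "b n \<noteq> 0" if "enat n \<le> N"
proof (cases n)
  case 0
  then show ?thesis using b0 by simp
next
  case (Suc m)
  then have "b n \<in> B" using b_in that by simp
  then show ?thesis using adm unfolding admissible_def by blast
qed

lemma cmod_b_le: "cmod (b n) \<le> \<mu>" if "1 \<le> n" "enat n \<le> N"
  unfolding mu using b_in[OF that] adm by (auto simp: admissible_def)

lemma mu_ge_one: "1 \<le> \<mu>"
proof -
  obtain c where c: "c \<in> B" using adm unfolding admissible_def by blast
  then have "1 \<le> cmod c"
    using adm by (intro one_le_cmod_quad_order[OF disc]) (auto simp: admissible_def)
  also have "\<dots> \<le> \<mu>" unfolding mu using c adm by (auto simp: admissible_def)
  finally show ?thesis .
qed

lemma PQ_in_order: "P n \<in> quad_order \<Delta>" "Q n \<in> quad_order \<Delta>" if "1 \<le> n" "enat n \<le> N"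
proof -
  have "reduced_ideal \<Delta> (col1_ideal \<Delta> (cf_mat a b n))"
    using run that unfolding cf_run_def by blast
  from col1_entries_in_order[OF disc this]
  show "P n \<in> quad_order \<Delta>" "Q n \<in> quad_order \<Delta>" by (simp_all add: cf_p_def cf_q_def)
qed

lemma det_nonzero: "det (cf_mat a b n) = (-1) ^ n * b n" "det (cf_mat a b n) \<noteq> 0"
  if "enat n \<le> N"
proof -
  have "b k \<noteq> 0" if "k < n" for k
    using that \<open>enat n \<le> N\<close> by (intro b_nonzero) (metis enat_ord_simps(1) less_imp_le order_trans)
  then show "det (cf_mat a b n) = (-1) ^ n * b n" using b0 by (intro det_cf_mat)
  then show "det (cf_mat a b n) \<noteq> 0" using b_nonzero that by simp
qed

lemma PQ_nonzero: "P n \<noteq> 0 \<or> Q n \<noteq> 0" if "enat n \<le> N"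
  using det_nonzero(2)[OF that] by (auto simp: det_2 cf_p_def cf_q_def)

text \<open>If \<open>Q n = 0\<close>, then \<open>P n\<close> is nonzero, so
  \<open>E n = - P n\<close> does not vanish, in agreement with \<open>eq_ratio\<close>. Otherwise
  \<open>E n = 0\<close> says that \<open>z = P n / Q n\<close>, which is the stopping
  condition.\<close>

lemma E_zero_iff: "E n = 0 \<longleftrightarrow> N = enat n" if "enat n \<le> N"
proof -
  have "E n = 0 \<longleftrightarrow> eq_ratio a b n z"
    using PQ_nonzero[OF that]
    by (cases "Q n = 0") (auto simp: cf_err_def eq_ratio_def field_simps)
  then show ?thesis using run that unfolding cf_run_def by blast
qed

section \<open>Decay of the errors and their products with denominators\<close>

lemma cmod_E_Suc: "cmod (E (Suc n)) \<le> \<epsilon> * cmod (E n)" if n: "enat (Suc n) \<le> N"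
proof -
  \<comment> \<open>A further step exists, so the run has not stopped at \<open>n\<close>; hence
    \<open>E n\<close> is nonzero and may be divided by.\<close>
  have lt: "enat n < N" using n by (simp add: Suc_ile_eq)
  then have le: "enat n \<le> N" by simp
  let ?M = "cf_mat a b n"
  define w where "w = moebius_act (matrix_inv ?M) z"
  \<comment> \<open>The error of the second column, which turns out to be \<open>- w * E n\<close>.
    Then \<open>b n * E (Suc n)\<close> is \<open>E n\<close> times
    \<open>a (Suc n) - b (Suc n) * w\<close>, and the disc from which \<open>a (Suc n)\<close> is
    chosen bounds that factor by \<open>\<epsilon> * cmod (b n)\<close>.\<close>
  define e' where "e' = ?M $ 2 $ 2 * z - ?M $ 1 $ 2"
  have E: "E n = ?M $ 2 $ 1 * z - ?M $ 1 $ 1"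
    by (simp add: cf_err_def cf_p_def cf_q_def)
  have E0: "E n \<noteq> 0" using E_zero_iff[OF le] lt by auto
  have bn: "b n \<noteq> 0" using b_nonzero[OF le] .
  have "w = e' / - E n"
    unfolding w_def moebius_act_matrix_inv[OF det_nonzero(2)[OF le]] e'_def E by simp
  then have e': "e' = - w * E n" using E0 by simp
  have "b n * E (Suc n) = a (Suc n) * E n + b (Suc n) * e'"
    unfolding E e'_def unfolding cf_err_def cf_p_def cf_q_def cf_mat_Suc
    using bn by (simp add: field_simps)
  also have "\<dots> = (a (Suc n) - b (Suc n) * w) * E n"
    unfolding e' by (simp add: algebra_simps)
  finally have "cmod (b n) * cmod (E (Suc n)) = cmod (a (Suc n) - b (Suc n) * w) * cmod (E n)"
    by (metis norm_mult)
  also have "cmod (a (Suc n) - b (Suc n) * w) \<le> \<epsilon> * cmod (b n)"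
  proof -
    have "a (Suc n) \<in> cball (b (Suc n) * w) (\<epsilon> * cmod (b n))"
      using run n unfolding cf_run_def w_def by (metis IntD2 diff_Suc_1 le_add1 plus_1_eq_Suc)
    then show ?thesis by (simp add: dist_norm norm_minus_commute)
  qed
  then have "cmod (a (Suc n) - b (Suc n) * w) * cmod (E n) \<le> \<epsilon> * cmod (b n) * cmod (E n)"
    by (rule mult_right_mono) simp
  finally have "cmod (b n) * cmod (E (Suc n)) \<le> cmod (b n) * (\<epsilon> * cmod (E n))"
    by (simp add: mult_ac)
  then show ?thesis using bn by simp
qed

text \<open>The terms in \<open>z\<close> cancel. Since the second column of each matrix is the
  first column of its predecessor, what remains is minus a determinant.\<close>

lemma Q_E_det: "Q n * E (Suc n) - Q (Suc n) * E n = (-1) ^ n * b (Suc n)"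
  if n: "enat (Suc n) \<le> N"
proof -
  have "Q n * E (Suc n) - Q (Suc n) * E n = - det (cf_mat a b (Suc n))"
    unfolding det_2 cf_mat_Suc(2) cf_err_def cf_p_def cf_q_def by (simp add: algebra_simps)
  then show ?thesis using det_nonzero(1)[OF n] by simp
qed

text \<open>The bound is the fixed point of
  \<open>x \<mapsto> \<epsilon>\<^sup>2 * x + \<mu>\<close>. The determinant identity and two
  contractions of the error show that the quantity grows at most by this map, and it starts at most
  \<mu>, strictly below the fixed point.\<close>

lemma cmod_Q_Suc_E_less: "cmod (Q (Suc n) * E n) < \<mu> / (1 - \<epsilon>\<^sup>2)" if "enat (Suc n) \<le> N"
  using that
proof (induction n)
  case 0
  have "Q (Suc 0) * E 0 = - b (Suc 0)" using Q_E_det[OF 0] start by simp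
  then have "cmod (Q (Suc 0) * E 0) \<le> \<mu>" using cmod_b_le[OF _ 0] by simp
  also have "\<dots> < \<mu> / (1 - \<epsilon>\<^sup>2)" using eps mu_ge_one by (simp add: less_divide_eq)
  finally show ?case .
next
  case (Suc n)
  have le: "enat (Suc n) \<le> N" using Suc.prems by (metis Suc_ile_eq less_imp_le)
  have "cmod (E (Suc (Suc n))) \<le> \<epsilon> * cmod (E (Suc n))" by (rule cmod_E_Suc[OF Suc.prems])
  also have "\<dots> \<le> \<epsilon> * (\<epsilon> * cmod (E n))"
    using cmod_E_Suc[OF le] eps(1) by (intro mult_left_mono) auto
  finally have E2: "cmod (E (Suc (Suc n))) \<le> \<epsilon>\<^sup>2 * cmod (E n)"
    by (simp add: power2_eq_square mult_ac)
  have "Q (Suc (Suc n)) * E (Suc n)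
      = Q (Suc n) * E (Suc (Suc n)) - (-1) ^ Suc n * b (Suc (Suc n))"
    using Q_E_det[OF Suc.prems] by (simp add: algebra_simps)
  then have "cmod (Q (Suc (Suc n)) * E (Suc n))
      \<le> cmod (Q (Suc n)) * cmod (E (Suc (Suc n))) + cmod (b (Suc (Suc n)))"
    using norm_triangle_ineq4[of "Q (Suc n) * E (Suc (Suc n))" "(-1) ^ Suc n * b (Suc (Suc n))"]
    by (simp add: norm_mult norm_power)
  also have "\<dots> \<le> cmod (Q (Suc n)) * (\<epsilon>\<^sup>2 * cmod (E n)) + \<mu>"
    using cmod_b_le[OF _ Suc.prems] E2 by (intro add_mono mult_left_mono) auto
  also have "\<dots> = \<epsilon>\<^sup>2 * cmod (Q (Suc n) * E n) + \<mu>" by (simp add: norm_mult)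
  also have "\<dots> < \<epsilon>\<^sup>2 * (\<mu> / (1 - \<epsilon>\<^sup>2)) + \<mu>"
    using mult_strict_left_mono[OF Suc.IH[OF le], of "\<epsilon>\<^sup>2"] eps(1) by simp
  also have "\<dots> = \<mu> / (1 - \<epsilon>\<^sup>2)" using eps(3) by (simp add: field_simps)
  finally show ?case .
qed

lemma cmod_Q_E_less: "cmod (Q n * E n) < \<epsilon> * \<mu> / (1 - \<epsilon>\<^sup>2)" if "1 \<le> n" "enat n \<le> N"
proof -
  obtain m where m: "n = Suc m" using \<open>1 \<le> n\<close> by (cases n) auto
  have le: "enat (Suc m) \<le> N" using that m by simp
  have "cmod (Q n * E n) \<le> cmod (Q n) * (\<epsilon> * cmod (E m))"
    unfolding m norm_mult using cmod_E_Suc[OF le] by (intro mult_left_mono) auto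
  also have "\<dots> = \<epsilon> * cmod (Q (Suc m) * E m)" by (simp add: m norm_mult)
  also have "\<dots> < \<epsilon> * (\<mu> / (1 - \<epsilon>\<^sup>2))"
    using cmod_Q_Suc_E_less[OF le] eps(1) by (rule mult_strict_left_mono)
  finally show ?thesis by simp
qed

lemma cmod_E_le: "cmod (E n) \<le> \<epsilon> ^ n" if "enat n \<le> N"
  using that
proof (induction n)
  case 0
  then show ?case by (simp add: start)
next
  case (Suc n)
  then have "enat n \<le> N" by (simp add: Suc_ile_eq)
  then have "\<epsilon> * cmod (E n) \<le> \<epsilon> * \<epsilon> ^ n" using Suc.IH eps(1) by simp
  then show ?case using cmod_E_Suc[OF Suc.prems] by simp
qed

text \<open>A finite run ends with error 0; in an infinite one the errors decay geometrically. This
  guarantees an index at which \<open>cmod (q * E n)\<close> is at most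
  \<open>1 / 2\<close>.\<close>

lemma E_arbitrarily_small:
  assumes "0 < \<delta>"
  obtains n where "enat n \<le> N" "cmod (E n) < \<delta>"
proof (cases N)
  case (enat n)
  then show ?thesis using that[of n] E_zero_iff[of n] assms by simp
next
  case infinity
  obtain n where "\<epsilon> ^ n < \<delta>" using real_arch_pow_inv[OF assms eps(2)] by blast
  then show ?thesis using that[of n] cmod_E_le[of n] infinity by simp
qed

section \<open>Comparison with fractions that are not convergents\<close>

lemma nonconvergent_separation:
  assumes pq: "p \<in> quad_order \<Delta>" "q \<in> quad_order \<Delta>" "q \<noteq> 0" "\<not> is_convergent a b N (p / q)"
    and n: "1 \<le> n" "enat n \<le> N"
  shows "1 \<le> cmod (q * E n) + cmod (Q n * (q * z - p))"
proof -
  have id: "q * E n - Q n * (q * z - p) = Q n * p - q * P n"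
    by (simp add: cf_err_def algebra_simps)
  have "\<not> eq_ratio a b n (p / q)" using pq(4) n unfolding is_convergent_def by blast
  \<comment> \<open>When \<open>Q n = 0\<close>, the assumption on \<open>p / q\<close> says
    nothing, but then \<open>P n\<close> and \<open>q\<close> are both nonzero.\<close>
  then have "Q n * p - q * P n \<noteq> 0"
    using pq(3) PQ_nonzero[OF n(2)]
    by (cases "Q n = 0") (auto simp: eq_ratio_def field_simps)
  then have "1 \<le> cmod (Q n * p - q * P n)"
    using pq PQ_in_order[OF n]
    by (intro one_le_cmod_quad_order[OF disc] quad_order_diff_mult[OF disc])
  then show ?thesis
    using norm_triangle_ineq4[of "q * E n" "Q n * (q * z - p)"] unfolding id by linarith
qed

lemma nonconvergent_lower_bound:
  assumes pq: "p \<in> quad_order \<Delta>" "q \<in> quad_order \<Delta>" "q \<noteq> 0" "\<not> is_convergent a b N (p / q)"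
  shows "(1 - \<epsilon>\<^sup>2) / (4 * \<mu>) < cmod (q * (q * z - p))"
proof -
  define S where "S n \<longleftrightarrow> enat n \<le> N \<and> cmod (q * E n) \<le> 1 / 2" for n
  obtain n0 where n0: "enat n0 \<le> N" "cmod (E n0) < 1 / (2 * cmod q)"
    using E_arbitrarily_small[of "1 / (2 * cmod q)"] pq(3) by auto
  then have "S n0" using pq(3) by (simp add: S_def norm_mult field_simps)
  moreover define n where "n = (LEAST n. S n)"
  ultimately have "S n" by (metis LeastI)
  have "1 \<le> cmod q" using one_le_cmod_quad_order[OF disc pq(2,3)] .
  \<comment> \<open>\<open>E 0\<close> has modulus 1, so \<open>cmod (q * E 0) \<ge> 1\<close>. The
    least index is thus positive: it has a predecessor, and the separation lemma applies to
    it.\<close>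
  then have "\<not> S 0" by (simp add: S_def start)
  then obtain m where m: "n = Suc m" using \<open>S n\<close> by (cases n) auto
  have le: "enat (Suc m) \<le> N" using \<open>S n\<close> m by (simp add: S_def)
  have "\<not> S m" using not_less_Least[of m S] m n_def by simp
  then have 1: "1 / 2 < cmod (q * E m)"
    using le unfolding S_def Suc_ile_eq by (meson less_imp_le not_le)
  define e where "e = q * z - p"
  have 2: "1 / 2 \<le> cmod (Q n * e)"
    using nonconvergent_separation[OF pq, of n] \<open>S n\<close> m by (simp add: S_def e_def)
  have "1 / 4 \<le> cmod (q * E m) * cmod (Q n * e)"
    using mult_mono[OF less_imp_le[OF 1] 2] by simp
  also have "\<dots> = cmod (Q (Suc m) * E m) * cmod (q * e)" by (simp add: m norm_mult)
  finally have 3: "1 / 4 \<le> cmod (Q (Suc m) * E m) * cmod (q * e)" .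
  \<comment> \<open>Positivity keeps the bound on \<open>Q (Suc m) * E m\<close> strict after
    multiplication.\<close>
  then have "0 < cmod (q * e)" by (cases "q * e = 0") auto
  then have "cmod (Q (Suc m) * E m) * cmod (q * e) < \<mu> / (1 - \<epsilon>\<^sup>2) * cmod (q * e)"
    using cmod_Q_Suc_E_less[OF le] by (rule mult_strict_right_mono[rotated])
  then have "1 / 4 < \<mu> / (1 - \<epsilon>\<^sup>2) * cmod (q * e)" using 3 by linarith
  then show ?thesis using eps(3) mu_ge_one unfolding e_def by (simp add: field_simps)
qed

text \<open>The constant is the quotient of the upper bound \<open>\<epsilon> * \<mu> / d\<close>
  for \<open>cmod (Q n * E n)\<close> by the lower bound \<open>d / (4 * \<mu>)\<close> for
  \<open>cmod (q * (q * z - p))\<close>, with \<open>d = 1 - \<epsilon>\<^sup>2\<close>.\<close>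

lemma best_approximation:
  assumes pq: "p \<in> quad_order \<Delta>" "q \<in> quad_order \<Delta>" "q \<noteq> 0" "\<not> is_convergent a b N (p / q)"
    and n: "1 \<le> n" "enat n \<le> N"
  shows "cmod (Q n * E n) < 4 * \<epsilon> * \<mu>\<^sup>2 * cmod (q * (q * z - p)) / (1 - \<epsilon>\<^sup>2)\<^sup>2"
proof -
  define d where "d = 1 - \<epsilon>\<^sup>2"
  have d: "0 < d" using eps(3) by (simp add: d_def)
  have "cmod (Q n * E n) < \<epsilon> * \<mu> / d" using cmod_Q_E_less[OF n] by (simp add: d_def)
  also have "\<dots> = 4 * \<epsilon> * \<mu>\<^sup>2 / d\<^sup>2 * (d / (4 * \<mu>))"
    using d mu_ge_one by (simp add: field_simps power2_eq_square)
  also have "\<dots> < 4 * \<epsilon> * \<mu>\<^sup>2 / d\<^sup>2 * cmod (q * (q * z - p))"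
    using nonconvergent_lower_bound[OF pq] d mu_ge_one eps(1)
    by (intro mult_strict_left_mono) (auto simp: d_def)
  finally show ?thesis by (simp add: d_def)
qed

text \<open>Inserting \<open>cmod q < r * cmod (Q n)\<close> and \<open>\<epsilon> < 1\<close> into
  the previous bound gives \<open>C * cmod (E n) < r * e\<close>. The product \<open>r * s\<close>
  must be bounded above by \<open>C\<close>, so that \<open>C\<close> can be replaced by it and
  \<open>r\<close> cancelled; \<open>s\<close> may have any sign.\<close>

lemma best_approximation_second_kind:
  assumes rs: "r * s \<le> (1 - \<epsilon>\<^sup>2)\<^sup>2 / (4 * \<mu>\<^sup>2)"
    and pq: "p \<in> quad_order \<Delta>" "q \<in> quad_order \<Delta>" "q \<noteq> 0" "\<not> is_convergent a b N (p / q)"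
    and n: "1 \<le> n" "enat n \<le> N"
    and less: "cmod q < r * cmod (Q n)"
  shows "s * cmod (E n) < cmod (q * z - p)"
proof -
  define C where "C = (1 - \<epsilon>\<^sup>2)\<^sup>2 / (4 * \<mu>\<^sup>2)"
  define e where "e = cmod (q * z - p)"
  have C: "0 < C" using eps(3) mu_ge_one by (simp add: C_def)
  have "0 < (1 - \<epsilon>\<^sup>2) / (4 * \<mu>)" using eps(3) mu_ge_one by simp
  also have "\<dots> < cmod q * e"
    using nonconvergent_lower_bound[OF pq] by (simp add: norm_mult e_def)
  finally have e: "0 < e" by (simp add: zero_less_mult_iff)
  \<comment> \<open>The upper bound on \<open>cmod q\<close> forces both factors to be positive, so
    each can be cancelled.\<close>
  have "0 < r * cmod (Q n)" using less pq(3) by (meson le_less_trans norm_ge_zero)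
  then have r: "0 < r" "0 < cmod (Q n)" by (simp_all add: zero_less_mult_iff)
  have "cmod (Q n) * cmod (E n) < \<epsilon> * (cmod q * e) / C"
    using best_approximation[OF pq n] by (simp add: C_def norm_mult e_def mult_ac)
  also have "\<dots> \<le> 1 * (r * cmod (Q n) * e) / C"
    using less eps e C r by (intro divide_right_mono mult_mono) auto
  finally have *: "C * cmod (E n) < r * e"
    using C r by (simp add: field_simps)
  have "r * (s * cmod (E n)) \<le> C * cmod (E n)"
    using mult_right_mono[OF rs, of "cmod (E n)"] by (simp add: C_def mult_ac)
  with * have "r * (s * cmod (E n)) < r * e" by linarith
  then show ?thesis using r(1) by (simp add: e_def)
qed

end

theorem theorem4p8:
  fixes \<Delta> :: int and B :: "complex set" and \<epsilon> \<mu> :: real and z :: complex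
    and a b :: "nat \<Rightarrow> complex" and N :: enat and n :: nat
  assumes "\<Delta> < 0" and "\<Delta> mod 4 \<in> {0, 1}"
    and "admissible \<Delta> B \<epsilon>"
    and "\<mu> = Max (cmod ` B)"
    and "cf_run \<Delta> B \<epsilon> z a b N"
    and "1 \<le> n" and "enat n \<le> N"
  shows "(\<forall>p \<in> quad_order \<Delta>. \<forall>q \<in> quad_order \<Delta>.
            q \<noteq> 0 \<and> \<not> is_convergent a b N (p / q) \<longrightarrow>
              cmod (cf_q a b n * (cf_q a b n * z - cf_p a b n))
                < 4 * \<epsilon> * \<mu>\<^sup>2 * cmod (q * (q * z - p)) / (1 - \<epsilon>\<^sup>2)\<^sup>2) \<and>
         (\<forall>r s :: real. r * s \<le> (1 - \<epsilon>\<^sup>2)\<^sup>2 / (4 * \<mu>\<^sup>2) \<longrightarrow>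
            (\<forall>p \<in> quad_order \<Delta>. \<forall>q \<in> quad_order \<Delta>.
               0 < cmod q \<and> cmod q < r * cmod (cf_q a b n) \<and> \<not> is_convergent a b N (p / q) \<longrightarrow>
                 cmod (q * z - p) > s * cmod (cf_q a b n * z - cf_p a b n)))"
proof -
  interpret cf_execution \<Delta> B \<epsilon> \<mu> z a b N
    using assms(1-5) by (rule cf_execution.intro)
  show ?thesis
  proof (intro conjI allI ballI impI; elim conjE)
    fix p q
    assume "p \<in> quad_order \<Delta>" "q \<in> quad_order \<Delta>" "q \<noteq> 0" "\<not> is_convergent a b N (p / q)"
    from best_approximation[OF this assms(6,7)]
    show "cmod (Q n * (Q n * z - P n))
        < 4 * \<epsilon> * \<mu>\<^sup>2 * cmod (q * (q * z - p)) / (1 - \<epsilon>\<^sup>2)\<^sup>2"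
      by (simp only: cf_err_def)
  next
    fix r s :: real and p q
    assume rs: "r * s \<le> (1 - \<epsilon>\<^sup>2)\<^sup>2 / (4 * \<mu>\<^sup>2)"
      and pq: "p \<in> quad_order \<Delta>" "q \<in> quad_order \<Delta>" "0 < cmod q" "\<not> is_convergent a b N (p / q)"
      and less: "cmod q < r * cmod (Q n)"
    have "q \<noteq> 0" using pq(3) by simp
    from best_approximation_second_kind[OF rs pq(1,2) this pq(4) assms(6,7) less]
    show "s * cmod (Q n * z - P n) < cmod (q * z - p)"
      by (simp only: cf_err_def)
  qed
qed

end
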